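(* Let $T_\theta$ be a causally masked Transformer with parameters $\theta \in \mathbb{R}^p$ and $D$ blocks, let $x = x_1 \dots x_n$ be an input token sequence, let $L(\theta) = \sum_{j=1}^{n-1} L_j(\theta)$ be the total next-token prediction loss of $T_\theta$ on $x$, and for a layer $k$ and a position $i$ let $\nabla_\theta L_j^{\mathrm{sg}(k,i)}$ denote the gradient of the position-$j$ loss with the stop-gradient operator applied to the residual stream vector $r^k_{\theta,i}(x)$ (all as defined in the context). Then for any layer $k \in \{0,\dots,D\}$ and any position $i \in \{1,\dots,n-1\}$, $$\nabla_\theta L = \nabla_\theta L^k_{i\,(\mathrm{direct})} + \nabla_\theta L^k_{i\,(\mathrm{pre\text{-}cached})} + \nabla_\theta L^k_{i\,(\mathrm{shared})},$$ where $$\nabla_\theta L^k_{i\,(\mathrm{direct})} = \nabla_\theta L_i - \nabla_\theta L_i^{\mathrm{sg}(k,i)},$$ $$\nabla_\theta L^k_{i\,(\mathrm{pre\text{-}cached})} = \sum_{j \ne i} \left[ \nabla_\theta L_j - \nabla_\theta L_j^{\mathrm{sg}(k,i)} \right],$$ $$\nabla_\theta L^k_{i\,(\mathrm{shared})} = \sum_{j} \nabla_\theta L_j^{\mathrm{sg}(k,i)},$$ with $j$ ranging over $\{1,\dots,n-1\}$ in both sums.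
   Context: Model. Inputs are variable-length sequences $x = x_1 \dots x_n$ of tokens from a discrete vocabulary. The model $T_\theta$ with parameters $\theta \in \mathbb{R}^p$ maps $x_1 \dots x_n$ to predictions $\hat{x}_2 \dots \hat{x}_{n+1}$, where the prediction made at position $i$ is $T_\theta(x)_i = \hat{x}_{i+1}$. It is computed through residual stream vectors $r^k_{\theta,i}(x) \in \mathbb{R}^d$ for layers $0 \le k \le D$ and positions $1 \le i \le n$: $$r^0_{\theta,i}(x) = h^0_\theta(x_i), \qquad r^k_{\theta,i}(x) = h^k_\theta\big(r^{k-1}_{\theta,1}(x), \dots, r^{k-1}_{\theta,i}(x)\big) \ \ (1 \le k \le D), \qquad \hat{x}_{i+1}(x) = h^{D+1}_\theta\big(r^D_{\theta,i}(x)\big).$$ Here $h^0_\theta$ is the embedding layer, $h^1_\theta, \dots, h^D_\theta$ are the Transformer blocks, and $h^{D+1}_\theta$ is the unembedding layer. All of these maps are assumed differentiable in $\theta$ and in their vector-valued inputs. Loss. For $1 \le j \le n-1$, $L_j(\theta) = \ell\big(x_{j+1}, T_\theta(x)_j\big)$ is the next-token prediction loss at position $j$, where $\ell$ is a loss function differentiable in its second argument (e.g. cross-entropy). The total loss is $L(\theta) = \sum_{j=1}^{n-1} L_j(\theta)$. Stop-gradient. Fix a layer $k$ and a position $i$. The superscript $\mathrm{sg}(k,i)$ means that a stop-gradient (detach) operator is applied to $r^k_{\theta,i}(x)$: its value in the forward pass is unchanged, but it is treated as a constant not depending on $\theta$ when differentiating. Precisely, for parameters $\theta_0$, let $L_j^{\mathrm{sg}(k,i)}(\theta)$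 be the number $\ell\big(x_{j+1}, h^{D+1}_\theta(\tilde r^D_j)\big)$, where the vectors $\tilde r^m_q \in \mathbb{R}^d$ ($0 \le m \le D$, $1 \le q \le n$) are defined by $\tilde r^k_i = r^k_{\theta_0,i}(x)$ (a fixed vector, not depending on $\theta$) and, for all $(m,q) \ne (k,i)$, by $\tilde r^0_q = h^0_\theta(x_q)$ if $m = 0$ and $\tilde r^m_q = h^m_\theta\big(\tilde r^{m-1}_1, \dots, \tilde r^{m-1}_q\big)$ if $1 \le m \le D$. Then $\nabla_\theta L_j^{\mathrm{sg}(k,i)}$ at the point $\theta_0$ is the gradient of this function with respect to $\theta$, evaluated at $\theta = \theta_0$. All gradients in the statement are evaluated at the same point $\theta_0$. *)

theory Defs
  imports "HOL-Analysis.Analysis"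
begin

(* Type parameters: 'v is the vocabulary, real^'p the parameter space, real^'d the residual
   stream space and 'y the space containing the predictions.  The maps h^1, ..., h^D are
   "block T 1", ..., "block T (depth T)"; other indices of "block T" are irrelevant.
   A block receives the whole nonempty prefix r_1, ..., r_i as a list. *)
record ('v, 'p::finite, 'd::finite, 'y) transformer =
  depth :: nat
  embed :: "real^'p \<Rightarrow> 'v \<Rightarrow> real^'d"
  block :: "nat \<Rightarrow> real^'p \<Rightarrow> (real^'d) list \<Rightarrow> real^'d"
  unembed :: "real^'p \<Rightarrow> real^'d \<Rightarrow> 'y"

(* Frechet differentiability at (t, rs) of the restriction of f to the finite-dimensional space
   'a x 'b^(length rs), whose dimension is not available as a type.  The derivative is
   (u, us) |-> A u + (SUM q. B q (us ! q)); the norm used on the product is the sum of the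
   norms of the components. *)
definition prefix_differentiable ::
  "('a::real_normed_vector \<Rightarrow> 'b::real_normed_vector list \<Rightarrow> 'c::real_normed_vector)
    \<Rightarrow> 'a \<Rightarrow> 'b list \<Rightarrow> bool" where
  "prefix_differentiable f t rs \<longleftrightarrow>
    (\<exists>A B. bounded_linear A \<and> (\<forall>q<length rs. bounded_linear (B q)) \<and>
      (\<forall>e>0. \<exists>\<delta>>0. \<forall>t' rs'. length rs' = length rs \<longrightarrow>
        norm (t' - t) + (\<Sum>q<length rs. norm (rs' ! q - rs ! q)) < \<delta> \<longrightarrow>
        norm (f t' rs' - f t rs - (A (t' - t) + (\<Sum>q<length rs. B q (rs' ! q - rs ! q))))
          \<le> e * (norm (t' - t) + (\<Sum>q<length rs. norm (rs' ! q - rs ! q)))))"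

definition differentiable_transformer ::
  "('v, 'p::finite, 'd::finite, 'y::real_normed_vector) transformer \<Rightarrow> bool" where
  "differentiable_transformer T \<longleftrightarrow>
    (\<forall>v \<theta>. (\<lambda>\<theta>'. embed T \<theta>' v) differentiable at \<theta>) \<and>
    (\<forall>k\<in>{1..depth T}. \<forall>\<theta> rs. rs \<noteq> [] \<longrightarrow> prefix_differentiable (block T k) \<theta> rs) \<and>
    (\<forall>\<theta> r. (\<lambda>(\<theta>', r'). unembed T \<theta>' r') differentiable at (\<theta>, r))"

(* Token x_i of the sequence xs; positions are numbered from 1. *)
definition token :: "'v list \<Rightarrow> nat \<Rightarrow> 'v" where
  "token xs i = xs ! (i - 1)"

(* residual T \<theta> xs k i is r^k_i(x). *)
primrec residual ::
  "('v, 'p::finite, 'd::finite, 'y) transformer \<Rightarrow> real^'p \<Rightarrow> 'v list \<Rightarrow> nat \<Rightarrow> nat \<Rightarrow> real^'d" where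
  "residual T \<theta> xs 0 i = embed T \<theta> (token xs i)"
| "residual T \<theta> xs (Suc k) i = block T (Suc k) \<theta> (map (residual T \<theta> xs k) [1..<Suc i])"

definition prediction ::
  "('v, 'p::finite, 'd::finite, 'y) transformer \<Rightarrow> real^'p \<Rightarrow> 'v list \<Rightarrow> nat \<Rightarrow> 'y" where
  "prediction T \<theta> xs i = unembed T \<theta> (residual T \<theta> xs (depth T) i)"

definition pos_loss ::
  "('v \<Rightarrow> 'y \<Rightarrow> real) \<Rightarrow> ('v, 'p::finite, 'd::finite, 'y) transformer \<Rightarrow> 'v list
    \<Rightarrow> nat \<Rightarrow> real^'p \<Rightarrow> real" where
  "pos_loss l T xs j \<theta> = l (token xs (j + 1)) (prediction T \<theta> xs j)"

(* {1..<length xs} is the set of positions 1, ..., n - 1. *)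
definition total_loss ::
  "('v \<Rightarrow> 'y \<Rightarrow> real) \<Rightarrow> ('v, 'p::finite, 'd::finite, 'y) transformer \<Rightarrow> 'v list
    \<Rightarrow> real^'p \<Rightarrow> real" where
  "total_loss l T xs \<theta> = (\<Sum>j\<in>{1..<length xs}. pos_loss l T xs j \<theta>)"

(* Forward pass at \<theta> in which the residual vector at layer k, position i is replaced by
   the constant it equals at \<theta>0. *)
primrec sg_residual ::
  "('v, 'p::finite, 'd::finite, 'y) transformer \<Rightarrow> 'v list \<Rightarrow> nat \<Rightarrow> nat \<Rightarrow> real^'p \<Rightarrow> real^'p
    \<Rightarrow> nat \<Rightarrow> nat \<Rightarrow> real^'d" where
  "sg_residual T xs k i \<theta>0 \<theta> 0 q =
    (if (0, q) = (k, i) then residual T \<theta>0 xs k i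
     else embed T \<theta> (token xs q))"
| "sg_residual T xs k i \<theta>0 \<theta> (Suc m) q =
    (if (Suc m, q) = (k, i) then residual T \<theta>0 xs k i
     else block T (Suc m) \<theta> (map (sg_residual T xs k i \<theta>0 \<theta> m) [1..<Suc q]))"

definition sg_loss ::
  "('v \<Rightarrow> 'y \<Rightarrow> real) \<Rightarrow> ('v, 'p::finite, 'd::finite, 'y) transformer \<Rightarrow> 'v list
    \<Rightarrow> nat \<Rightarrow> nat \<Rightarrow> real^'p \<Rightarrow> nat \<Rightarrow> real^'p \<Rightarrow> real" where
  "sg_loss l T xs k i \<theta>0 j \<theta> =
    l (token xs (j + 1)) (unembed T \<theta> (sg_residual T xs k i \<theta>0 \<theta> (depth T) j))"

(* Only meaningful where f is differentiable; the gradient is then unique. *)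
definition grad :: "('a::real_inner \<Rightarrow> real) \<Rightarrow> 'a \<Rightarrow> 'a" where
  "grad f x = (THE D. GDERIV f x :> D)"

definition grad_sg ::
  "('v \<Rightarrow> 'y \<Rightarrow> real) \<Rightarrow> ('v, 'p::finite, 'd::finite, 'y) transformer \<Rightarrow> 'v list
    \<Rightarrow> nat \<Rightarrow> nat \<Rightarrow> nat \<Rightarrow> real^'p \<Rightarrow> real^'p" where
  "grad_sg l T xs k i j \<theta>0 = grad (sg_loss l T xs k i \<theta>0 j) \<theta>0"

definition grad_direct ::
  "('v \<Rightarrow> 'y \<Rightarrow> real) \<Rightarrow> ('v, 'p::finite, 'd::finite, 'y) transformer \<Rightarrow> 'v list
    \<Rightarrow> nat \<Rightarrow> nat \<Rightarrow> real^'p \<Rightarrow> real^'p" where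
  "grad_direct l T xs k i \<theta>0 = grad (pos_loss l T xs i) \<theta>0 - grad_sg l T xs k i i \<theta>0"

definition grad_precached ::
  "('v \<Rightarrow> 'y \<Rightarrow> real) \<Rightarrow> ('v, 'p::finite, 'd::finite, 'y) transformer \<Rightarrow> 'v list
    \<Rightarrow> nat \<Rightarrow> nat \<Rightarrow> real^'p \<Rightarrow> real^'p" where
  "grad_precached l T xs k i \<theta>0 =
    (\<Sum>j\<in>{1..<length xs} - {i}. grad (pos_loss l T xs j) \<theta>0 - grad_sg l T xs k i j \<theta>0)"

definition grad_shared ::
  "('v \<Rightarrow> 'y \<Rightarrow> real) \<Rightarrow> ('v, 'p::finite, 'd::finite, 'y) transformer \<Rightarrow> 'v list
    \<Rightarrow> nat \<Rightarrow> nat \<Rightarrow> real^'p \<Rightarrow> real^'p" where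
  "grad_shared l T xs k i \<theta>0 = (\<Sum>j\<in>{1..<length xs}. grad_sg l T xs k i j \<theta>0)"

end

theory Submission
  imports Defs
begin

text \<open>
  The stop-gradient terms cancel algebraically, so the identity reduces to additivity of the
  gradient. The gradient is additive only at points of differentiability, and the work lies in
  propagating differentiability through the layers: each block is differentiable on the space of
  prefixes of a given length, which calls for a chain rule for functions of lists.
\<close>

text \<open>The linear part is bounded by an operator constant \<open>K\<close> and the remainder,
  taken with \<open>e = 1\<close>, adds at most \<open>norm (y - x)\<close>. This controls the
  increments of the inner functions in the chain rule for prefixes.\<close>

lemma has_derivative_eventually_norm_le:
  assumes "(f has_derivative f') (at x)"
  shows "\<exists>C\<ge>0. \<forall>\<^sub>F y in nhds x. norm (f y - f x) \<le> C * norm (y - x)"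
proof -
  from assms have bl: "bounded_linear f'" and
    rem: "\<forall>e>0. \<exists>d>0. \<forall>y. norm (y - x) < d \<longrightarrow> norm (f y - f x - f' (y - x)) \<le> e * norm (y - x)"
    unfolding has_derivative_at_alt by auto
  from rem obtain d where "d > 0" and
    d: "\<And>y. norm (y - x) < d \<Longrightarrow> norm (f y - f x - f' (y - x)) \<le> 1 * norm (y - x)"
    by (meson zero_less_one)
  from bounded_linear.nonneg_bounded[OF bl]
  obtain K where "K \<ge> 0" and K: "\<And>h. norm (f' h) \<le> norm h * K"
    by blast
  have "norm (f y - f x) \<le> (K + 1) * norm (y - x)" if "dist y x < d" for y
  proof -
    have "norm (f y - f x) \<le> norm (f y - f x - f' (y - x)) + norm (f' (y - x))"
      by (metis diff_add_cancel norm_triangle_ineq)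
    also have "\<dots> \<le> 1 * norm (y - x) + norm (y - x) * K"
      using d[of y] K[of "y - x"] that by (intro add_mono) (auto simp: dist_norm)
    finally show ?thesis
      by (simp add: algebra_simps)
  qed
  then have "\<forall>\<^sub>F y in nhds x. norm (f y - f x) \<le> (K + 1) * norm (y - x)"
    unfolding eventually_nhds_metric using \<open>d > 0\<close> by blast
  with \<open>K \<ge> 0\<close> show ?thesis
    by (intro exI[of _ "K + 1"]) auto
qed

lemma has_derivative_zeroI:
  assumes "\<And>e. e > 0 \<Longrightarrow> \<forall>\<^sub>F y in nhds x. norm (f y - f x) \<le> e * norm (y - x)"
  shows "(f has_derivative (\<lambda>_. 0)) (at x)"
  using assms unfolding has_derivative_at_alt eventually_nhds_metric
  by (auto simp: dist_norm)

text \<open>The inner increments are O(\<open>norm (s - t)\<close>), so a remainder of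
  \<open>f\<close> that is small relative to the product norm is also small relative to
  \<open>norm (s - t)\<close>. The parameter enters twice, directly and through each list entry, as
  it does in a Transformer block.\<close>

lemma prefix_differentiable_chain:
  fixes f :: "'a::real_normed_vector \<Rightarrow> 'b::real_normed_vector list \<Rightarrow> 'c::real_normed_vector"
    and g :: "'q \<Rightarrow> 'a \<Rightarrow> 'b"
  assumes f: "prefix_differentiable f t (map (\<lambda>q. g q t) qs)"
    and g: "\<And>q. q \<in> set qs \<Longrightarrow> g q differentiable at t"
  shows "(\<lambda>s. f s (map (\<lambda>q. g q s) qs)) differentiable at t"
proof -
  define n where "n = length qs"
  define G where "G j = g (qs ! j)" for j
  define F where "F s = f s (map (\<lambda>q. g q s) qs)" for s
  \<comment> \<open>The product norm from \<open>prefix_differentiable_def\<close>, evaluated at the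
    joint increment of the parameter and the list entries.\<close>
  define S where "S s = norm (s - t) + (\<Sum>j<n. norm (G j s - G j t))" for s
  from f obtain A B where A: "bounded_linear A" and B: "\<And>j. j < n \<Longrightarrow> bounded_linear (B j)"
    and AB: "\<forall>e>0. \<exists>\<delta>>0. \<forall>t' rs'. length rs' = n \<longrightarrow>
        norm (t' - t) + (\<Sum>j<n. norm (rs' ! j - map (\<lambda>q. g q t) qs ! j)) < \<delta> \<longrightarrow>
        norm (f t' rs' - f t (map (\<lambda>q. g q t) qs) -
            (A (t' - t) + (\<Sum>j<n. B j (rs' ! j - map (\<lambda>q. g q t) qs ! j))))
          \<le> e * (norm (t' - t) + (\<Sum>j<n. norm (rs' ! j - map (\<lambda>q. g q t) qs ! j)))"
    unfolding prefix_differentiable_def n_def length_map by blast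
  have rem: "\<exists>\<delta>>0. \<forall>s. S s < \<delta> \<longrightarrow>
      norm (F s - F t - (A (s - t) + (\<Sum>j<n. B j (G j s - G j t)))) \<le> e * S s"
    if "e > 0" for e
  proof -
    obtain \<delta> where "\<delta> > 0" and \<delta>: "\<forall>t' rs'. length rs' = n \<longrightarrow>
        norm (t' - t) + (\<Sum>j<n. norm (rs' ! j - map (\<lambda>q. g q t) qs ! j)) < \<delta> \<longrightarrow>
        norm (f t' rs' - f t (map (\<lambda>q. g q t) qs) -
            (A (t' - t) + (\<Sum>j<n. B j (rs' ! j - map (\<lambda>q. g q t) qs ! j))))
          \<le> e * (norm (t' - t) + (\<Sum>j<n. norm (rs' ! j - map (\<lambda>q. g q t) qs ! j)))"
      using AB \<open>e > 0\<close> by meson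
    have "norm (F s - F t - (A (s - t) + (\<Sum>j<n. B j (G j s - G j t)))) \<le> e * S s"
      if "S s < \<delta>" for s
      using \<delta>[rule_format, of "map (\<lambda>q. g q s) qs" s] that
      by (simp add: S_def F_def G_def n_def cong: sum.cong_simp)
    with \<open>\<delta> > 0\<close> show ?thesis
      by blast
  qed
  have "G j differentiable at t" if "j < n" for j
    using g that by (simp add: G_def n_def)
  then have "\<forall>j. \<exists>D. j < n \<longrightarrow> (G j has_derivative D) (at t)"
    unfolding differentiable_def by blast
  then obtain G' where G': "\<And>j. j < n \<Longrightarrow> (G j has_derivative G' j) (at t)"
    by metis
  have "\<exists>C\<ge>0. \<forall>\<^sub>F s in nhds t. norm (G j s - G j t) \<le> C * norm (s - t)" if "j < n" for j
    using has_derivative_eventually_norm_le[OF G'[OF that]] .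
  then obtain C where C0: "\<And>j. j < n \<Longrightarrow> C j \<ge> 0"
    and C: "\<And>j. j < n \<Longrightarrow> \<forall>\<^sub>F s in nhds t. norm (G j s - G j t) \<le> C j * norm (s - t)"
    by metis
  \<comment> \<open>The summand 1 accounts for the increment of the parameter itself; it also keeps
    \<open>K\<close> positive when the list is empty, so that dividing by \<open>K\<close> is
    safe.\<close>
  define K where "K = 1 + (\<Sum>j<n. C j)"
  have "K > 0"
    unfolding K_def using C0 by (intro add_pos_nonneg sum_nonneg) auto
  have "\<forall>\<^sub>F s in nhds t. \<forall>j\<in>{..<n}. norm (G j s - G j t) \<le> C j * norm (s - t)"
    using C by (intro eventually_ball_finite) auto
  then have S_le: "\<forall>\<^sub>F s in nhds t. S s \<le> K * norm (s - t)"
  proof eventually_elim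
    case (elim s)
    then have "(\<Sum>j<n. norm (G j s - G j t)) \<le> (\<Sum>j<n. C j * norm (s - t))"
      by (intro sum_mono) auto
    then show ?case
      by (simp add: S_def K_def distrib_right sum_distrib_right)
  qed
  \<comment> \<open>Linear part of the expansion of \<open>f\<close>, composed with the inner
    functions. Writing \<open>F = h + (F - h)\<close> separates a term differentiable by linearity
    from the pure remainder, whose derivative is zero.\<close>
  define h where "h s = A s + (\<Sum>j<n. B j (G j s))" for s
  have "(h has_derivative (\<lambda>u. A u + (\<Sum>j<n. B j (G' j u)))) (at t)"
    unfolding h_def
    by (rule has_derivative_add[OF bounded_linear_imp_has_derivative[OF A] has_derivative_sum],
        rule bounded_linear.has_derivative[OF B G']) simp_all
  moreover have "((\<lambda>s. F s - h s) has_derivative (\<lambda>_. 0)) (at t)"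
  proof (rule has_derivative_zeroI)
    fix e :: real assume "e > 0"
    \<comment> \<open>Tolerance \<open>e / K\<close> and radius \<open>\<delta> / K\<close> both
      compensate for the factor \<open>K\<close> lost when \<open>S s\<close> is bounded by
      \<open>K * norm (s - t)\<close>.\<close>
    with \<open>K > 0\<close> have "e / K > 0" by simp
    from rem[OF this] obtain \<delta> where "\<delta> > 0" and
      \<delta>: "\<And>s. S s < \<delta> \<Longrightarrow>
        norm (F s - F t - (A (s - t) + (\<Sum>j<n. B j (G j s - G j t)))) \<le> e / K * S s"
      by blast
    have "\<forall>\<^sub>F s in nhds t. norm (s - t) < \<delta> / K"
      unfolding eventually_nhds_metric dist_norm using \<open>\<delta> > 0\<close> \<open>K > 0\<close>
      by (intro exI[of _ "\<delta> / K"]) auto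
    with S_le
    show "\<forall>\<^sub>F s in nhds t. norm (F s - h s - (F t - h t)) \<le> e * norm (s - t)"
    proof eventually_elim
      case (elim s)
      have "S s < \<delta>"
        using elim(1) elim(2)[unfolded pos_less_divide_eq[OF \<open>K > 0\<close>]]
        by (simp add: mult.commute)
      have lin: "A (s - t) + (\<Sum>j<n. B j (G j s - G j t)) = h s - h t"
      proof -
        have "(\<Sum>j<n. B j (G j s - G j t)) = (\<Sum>j<n. B j (G j s) - B j (G j t))"
          by (intro sum.cong refl linear_diff bounded_linear.linear B) simp
        then show ?thesis
          by (simp add: h_def linear_diff[OF bounded_linear.linear[OF A]] sum_subtractf)
      qed
      have "norm (F s - h s - (F t - h t)) \<le> e / K * S s"
        using \<delta>[OF \<open>S s < \<delta>\<close>] unfolding lin by (simp add: algebra_simps)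
      also have "\<dots> \<le> e / K * (K * norm (s - t))"
        using elim(1) \<open>e / K > 0\<close> by (intro mult_left_mono) auto
      finally show ?case
        using \<open>K > 0\<close> by simp
    qed
  qed
  ultimately have "((\<lambda>s. h s + (F s - h s)) has_derivative
      (\<lambda>u. A u + (\<Sum>j<n. B j (G' j u)) + 0)) (at t)"
    by (rule has_derivative_add)
  then show ?thesis
    unfolding F_def differentiable_def by auto
qed

text \<open>Induction over layers, with \<open>q\<close> arbitrary because a block at position
  \<open>q\<close> reads all positions up to \<open>q\<close> of the layer below. The bound
  \<open>q \<ge> 1\<close> makes this prefix nonempty, as
  \<open>differentiable_transformer_def\<close> demands.\<close>

lemma residual_differentiable:
  assumes T: "differentiable_transformer T" and "m \<le> depth T" "q \<ge> 1"
  shows "(\<lambda>\<theta>. residual T \<theta> xs m q) differentiable at \<theta>0"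
  using assms(2,3)
proof (induction m arbitrary: q)
  case 0
  then show ?case
    using T by (simp add: differentiable_transformer_def)
next
  case (Suc m)
  from T Suc.prems have
    "prefix_differentiable (block T (Suc m)) \<theta>0 (map (residual T \<theta>0 xs m) [1..<Suc q])"
    by (auto simp: differentiable_transformer_def simp del: upt_Suc)
  then have "(\<lambda>\<theta>. block T (Suc m) \<theta> (map (\<lambda>p. residual T \<theta> xs m p) [1..<Suc q]))
      differentiable at \<theta>0"
    by (rule prefix_differentiable_chain) (use Suc in auto)
  then show ?case
    by simp
qed

text \<open>The set \<open>Y\<close> admits losses that are smooth only relative to the possible
  predictions, such as cross-entropy on vectors with positive coordinates.\<close>

lemma pos_loss_differentiable:
  fixes T :: "('v, 'p::finite, 'd::finite, 'y::euclidean_space) transformer"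
  assumes T: "differentiable_transformer T"
    and Y: "\<And>\<theta> r. unembed T \<theta> r \<in> Y"
    and l: "\<And>v. l v differentiable_on Y"
    and "j \<ge> 1"
  shows "pos_loss l T xs j differentiable at \<theta>0"
proof -
  let ?r = "\<lambda>\<theta>. residual T \<theta> xs (depth T) j"
  from T have "(\<lambda>(\<theta>, r). unembed T \<theta> r) differentiable at (\<theta>0, ?r \<theta>0)"
    by (simp add: differentiable_transformer_def)
  moreover have "(\<lambda>\<theta>. (\<theta>, ?r \<theta>)) differentiable at \<theta>0"
    using residual_differentiable[OF T order_refl \<open>j \<ge> 1\<close>]
    unfolding differentiable_def using has_derivative_Pair[OF has_derivative_ident] by blast
  ultimately have "(\<lambda>(\<theta>, r). unembed T \<theta> r) \<circ> (\<lambda>\<theta>. (\<theta>, ?r \<theta>)) differentiable at \<theta>0"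
    by (intro differentiable_chain_at) auto
  then have p: "(\<lambda>\<theta>. prediction T \<theta> xs j) differentiable at \<theta>0"
    by (simp add: o_def prediction_def)
  \<comment> \<open>Predictions never leave \<open>Y\<close>, so differentiability within
    \<open>Y\<close> restricts to the range of the prediction map, which is the set that the
    relative chain rule asks for.\<close>
  have "l (token xs (j + 1)) differentiable
      at (prediction T \<theta>0 xs j) within range (\<lambda>\<theta>. prediction T \<theta> xs j)"
    using l[of "token xs (j + 1)"] Y unfolding differentiable_on_def
    by (force simp: prediction_def intro: differentiable_within_subset[of _ _ Y])
  with p have "l (token xs (j + 1)) \<circ> (\<lambda>\<theta>. prediction T \<theta> xs j) differentiable at \<theta>0"
    by (intro differentiable_chain_within)
  then show ?thesis
    by (simp add: o_def pos_loss_def[abs_def])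
qed

lemma GDERIV_unique: "GDERIV f x :> D \<Longrightarrow> GDERIV f x :> E \<Longrightarrow> D = E"
  unfolding gderiv_def by (metis has_derivative_unique vector_eq_ldot)

lemma grad_eqI: "GDERIV f x :> D \<Longrightarrow> grad f x = D"
  unfolding grad_def by (blast intro: the_equality GDERIV_unique)

lemma GDERIV_grad:
  fixes f :: "'a::euclidean_space \<Rightarrow> real"
  assumes "f differentiable at x"
  shows "GDERIV f x :> grad f x"
proof -
  from assms obtain f' where f': "(f has_derivative f') (at x)"
    unfolding differentiable_def by blast
  then interpret linear f'
    by (rule has_derivative_linear)
  \<comment> \<open>Riesz representation in finite dimension: the coordinates of the gradient are
    the values of \<open>f'\<close> on the basis.\<close>
  have "f' = (\<lambda>h. h \<bullet> (\<Sum>b\<in>Basis. f' b *\<^sub>R b))"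
  proof
    fix h
    have "f' h = f' (\<Sum>b\<in>Basis. (h \<bullet> b) *\<^sub>R b)"
      by (simp add: euclidean_representation)
    also have "\<dots> = h \<bullet> (\<Sum>b\<in>Basis. f' b *\<^sub>R b)"
      by (simp add: sum scale inner_sum_right mult.commute)
    finally show "f' h = h \<bullet> (\<Sum>b\<in>Basis. f' b *\<^sub>R b)" .
  qed
  with f' have "GDERIV f x :> (\<Sum>b\<in>Basis. f' b *\<^sub>R b)"
    unfolding gderiv_def by simp
  then show ?thesis
    by (simp add: grad_eqI)
qed

text \<open>Since \<open>grad\<close> is a definite description, differentiability of each summand
  is what makes the vectors on the right genuine gradients; the sum rule and bilinearity of the
  inner product then give additivity.\<close>

lemma grad_sum:
  fixes f :: "'i \<Rightarrow> 'a::euclidean_space \<Rightarrow> real"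
  assumes "\<And>j. j \<in> J \<Longrightarrow> f j differentiable at x"
  shows "grad (\<lambda>y. \<Sum>j\<in>J. f j y) x = (\<Sum>j\<in>J. grad (f j) x)"
proof (rule grad_eqI)
  show "GDERIV (\<lambda>y. \<Sum>j\<in>J. f j y) x :> (\<Sum>j\<in>J. grad (f j) x)"
    using GDERIV_grad[OF assms] unfolding gderiv_def inner_sum_right
    by (intro has_derivative_sum)
qed

theorem proposition3p1:
  fixes T :: "('v, 'p::finite, 'd::finite, 'y::euclidean_space) transformer"
    and l :: "'v \<Rightarrow> 'y \<Rightarrow> real"
    and Y :: "'y set"
    and xs :: "'v list"
    and \<theta>0 :: "real^'p"
    and k i :: nat
  assumes "differentiable_transformer T"
    and "\<And>\<theta> r. unembed T \<theta> r \<in> Y"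
    and "\<And>v. l v differentiable_on Y"
    and "k \<in> {0..depth T}"
    and "i \<in> {1..<length xs}"
  shows "grad (total_loss l T xs) \<theta>0 =
    grad_direct l T xs k i \<theta>0 + grad_precached l T xs k i \<theta>0 + grad_shared l T xs k i \<theta>0"
proof -
  let ?J = "{1..<length xs}"
  \<comment> \<open>The direct term is exactly the summand \<open>j = i\<close> left out of the
    pre-cached sum; \<open>i\<close> lies in the index range by hypothesis.\<close>
  have "grad_direct l T xs k i \<theta>0 + grad_precached l T xs k i \<theta>0 =
      (\<Sum>j\<in>?J. grad (pos_loss l T xs j) \<theta>0 - grad_sg l T xs k i j \<theta>0)"
    unfolding grad_direct_def grad_precached_def
    using assms(5) by (intro sum.remove[symmetric]) auto
  then have "grad_direct l T xs k i \<theta>0 + grad_precached l T xs k i \<theta>0 + grad_shared l T xs k i \<theta>0 =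
      (\<Sum>j\<in>?J. grad (pos_loss l T xs j) \<theta>0)"
    by (simp add: grad_shared_def sum_subtractf)
  also have "\<dots> = grad (\<lambda>\<theta>. \<Sum>j\<in>?J. pos_loss l T xs j \<theta>) \<theta>0"
    using pos_loss_differentiable[OF assms(1-3)] by (intro grad_sum[symmetric]) auto
  also have "\<dots> = grad (total_loss l T xs) \<theta>0"
    by (simp add: total_loss_def[abs_def])
  finally show ?thesis ..
qed

end
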